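(* There exist a constant $c > 0$ and, for each $n \ge 2$, a regular language $L_n$ that is not suffix-convex and is accepted by a DFA with $O(n)$ states, such that every witness $(u,v,w)$ to the failure of suffix-convexity of $L_n$ satisfies $|w| \ge c n^3$; i.e. the size of the minimal witness is $\Omega(n^3)$.
   Context: A word $u$ is a suffix of $v$ if $v = xu$ for some word $x$. A witness to the failure of suffix-convexity of $L$ is a triple $(u,v,w)$ with $u,w \in L$, $v \notin L$, $u$ a suffix of $v$ and $v$ a suffix of $w$; its size is $|w|$. $L$ is suffix-convex iff no witness exists. *)

theory Defs
  imports Complex_Main "HOL-Library.Sublist" "HOL-Library.Landau_Symbols"
begin

record ('q, 'a) dfa =
  states :: "'q set"
  init :: 'q
  final :: "'q set"
  trans_fun :: "'q \<Rightarrow> 'a \<Rightarrow> 'q"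

definition is_dfa :: "'a set \<Rightarrow> ('q, 'a) dfa \<Rightarrow> bool" where
  "is_dfa \<Sigma> M \<longleftrightarrow>
     finite \<Sigma> \<and> finite (states M) \<and> init M \<in> states M \<and> final M \<subseteq> states M \<and>
     (\<forall>q \<in> states M. \<forall>a \<in> \<Sigma>. trans_fun M q a \<in> states M)"

definition dfa_lang :: "'a set \<Rightarrow> ('q, 'a) dfa \<Rightarrow> 'a list set" where
  "dfa_lang \<Sigma> M = {w \<in> lists \<Sigma>. foldl (trans_fun M) (init M) w \<in> final M}"

text \<open>Fixing the state type to \<^typ>\<open>nat\<close> is no restriction, as state sets are finite.\<close>

definition regular_lang :: "'a set \<Rightarrow> 'a list set \<Rightarrow> bool" where
  "regular_lang \<Sigma> L \<longleftrightarrow> (\<exists>M :: (nat, 'a) dfa. is_dfa \<Sigma> M \<and> dfa_lang \<Sigma> M = L)"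

definition suffix_convexity_witness :: "'a list set \<Rightarrow> 'a list \<Rightarrow> 'a list \<Rightarrow> 'a list \<Rightarrow> bool" where
  "suffix_convexity_witness L u v w \<longleftrightarrow>
     u \<in> L \<and> w \<in> L \<and> v \<notin> L \<and> suffix u v \<and> suffix v w"

definition suffix_convex :: "'a list set \<Rightarrow> bool" where
  "suffix_convex L \<longleftrightarrow> \<not> (\<exists>u v w. suffix_convexity_witness L u v w)"

end

theory Submission imports Defs begin

text \<open>
  Consider words \<open>1\<^sup>i 0\<^sup>k\<close> with \<open>1 \<le> i \<le> 3\<close>. Arrange membership to depend on whether \<open>k\<close> is a
  positive multiple of a modulus \<open>m\<^sub>i\<close>, positively for \<open>i = 1, 3\<close> and negatively for \<open>i = 2\<close>.
  Suffixes starting with \<open>1\<close> keep the block \<open>0\<^sup>k\<close>, so every witness has the form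
  \<open>(1 0\<^sup>k, 1\<^sup>2 0\<^sup>k, 1\<^sup>3 0\<^sup>k)\<close> where \<open>k\<close> is positive and divisible by all three moduli. Taking the
  pairwise coprime moduli \<open>2n - 1\<close>, \<open>2n\<close>, \<open>2n + 1\<close> forces \<open>k\<close> to be cubic in \<open>n\<close>, while
  three disjoint cycles of these lengths suffice for a DFA.
\<close>

definition block_word :: "nat \<Rightarrow> nat \<Rightarrow> nat list" where
  "block_word i k = replicate i 1 @ replicate k 0"

definition modulus :: "nat \<Rightarrow> nat \<Rightarrow> nat" where
  "modulus n i = 2 * n - 2 + i"

text \<open>Without \<open>0 < k\<close>, the words 1, 11, 111 would form a witness of length 3, as
  0 is divisible by every modulus. The inequality of truth values is an exclusive or, negating the
  condition exactly for \<open>i = 2\<close>.\<close>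

definition cubic_lang :: "nat \<Rightarrow> nat list set" where
  "cubic_lang n =
     {block_word i k | i k. i \<in> {1, 2, 3} \<and> (i = 2) \<noteq> (0 < k \<and> modulus n i dvd k)}"

text \<open>
  The state \<open>i + 4 * j\<close> with \<open>i \<in> {1, 2, 3}\<close> records \<open>i\<close> leading ones followed by no zero
  (\<open>j = 0\<close>) or by a positive number of zeros congruent to \<open>j\<close>, where \<open>1 \<le> j \<le> modulus n i\<close>.
  State \<open>0\<close> is initial and state \<open>4\<close> is the sink.
\<close>

definition cubic_step :: "nat \<Rightarrow> nat \<Rightarrow> nat \<Rightarrow> nat" where
  "cubic_step n q x =
     (if x = 1 then (if q < 3 then q + 1 else 4)
      else if q mod 4 = 0 then 4
      else if q div 4 < modulus n (q mod 4) then q + 4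
      else q mod 4 + 4)"

text \<open>For \<open>n \<ge> 1\<close> the largest code is
  \<open>3 + 4 * (2 * n + 1) = 8 * n + 7\<close>. Since \<open>j\<close> counts from 1 up to the
  modulus, \<open>j = modulus n i\<close> marks the positive multiples, apart from
  \<open>j = 0\<close> for no zero.\<close>

definition cubic_dfa :: "nat \<Rightarrow> (nat, nat) dfa" where
  "cubic_dfa n =
     \<lparr>states = {..<8 * n + 8}, init = 0,
      final = {q. q < 8 * n + 8 \<and> q mod 4 \<noteq> 0 \<and>
                  (q mod 4 = 2) \<noteq> (q div 4 = modulus n (q mod 4))},
      trans_fun = cubic_step n\<rparr>"

section \<open>Shape and length of witnesses\<close>

lemma block_word_eq_iff: "block_word i k = block_word j l \<longleftrightarrow> i = j \<and> k = l"
proof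
  assume "block_word i k = block_word j l"
  then have "filter (\<lambda>x. x = 1) (block_word i k) = filter (\<lambda>x. x = 1) (block_word j l)"
    and "filter (\<lambda>x. x = 0) (block_word i k) = filter (\<lambda>x. x = 0) (block_word j l)"
    by simp_all
  then show "i = j \<and> k = l"
    by (simp add: block_word_def filter_replicate)
qed simp

lemma suffix_block_wordE:
  assumes "suffix v (block_word i k)"
  obtains j l where "v = block_word j l" "j \<le> i" "0 < j \<Longrightarrow> l = k"
proof -
  obtain d where "v = drop d (block_word i k)"
    using assms by (metis suffix_def append_eq_conv_conj)
  \<comment> \<open>Truncated subtraction covers both cases: \<open>d \<le> i\<close> removes only
    ones, and \<open>d > i\<close> leaves no ones.\<close>
  then have "v = block_word (i - d) (k - (d - i))"
    by (simp add: block_word_def)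
  then show ?thesis by (rule that) auto
qed

lemma block_word_in_cubic_lang_iff:
  "block_word i k \<in> cubic_lang n \<longleftrightarrow>
     i \<in> {1, 2, 3} \<and> (i = 2) \<noteq> (0 < k \<and> modulus n i dvd k)"
  unfolding cubic_lang_def by (auto simp: block_word_eq_iff)

lemma suffix_block_word: "i \<le> j \<Longrightarrow> suffix (block_word i k) (block_word j k)"
  unfolding block_word_def
  by (metis append.assoc le_add_diff_inverse2 replicate_add suffixI)

lemma suffix_convexity_witness_cubic_langD:
  assumes "suffix_convexity_witness (cubic_lang n) u v w"
  obtains k where "w = block_word 3 k" "0 < k"
    "modulus n 1 dvd k" "modulus n 2 dvd k" "modulus n 3 dvd k"
proof -
  have u: "u \<in> cubic_lang n" and v: "v \<notin> cubic_lang n" and w: "w \<in> cubic_lang n"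
    and uv: "suffix u v" and vw: "suffix v w"
    using assms by (auto simp: suffix_convexity_witness_def)
  obtain c k where wk: "w = block_word c k" and c: "c \<in> {1, 2, 3}"
    using w by (auto simp: cubic_lang_def)
  obtain b l where vl: "v = block_word b l" "b \<le> c" "0 < b \<Longrightarrow> l = k"
    using suffix_block_wordE[OF vw[unfolded wk]] by blast
  obtain a j where uj: "u = block_word a j" "a \<le> b" "0 < a \<Longrightarrow> j = l"
    using suffix_block_wordE[OF uv[unfolded vl]] by blast
  \<comment> \<open>Membership of \<open>u\<close> gives \<open>0 < a\<close>, hence all three words
    keep the same zeros. Differing membership then forces \<open>a < b < c\<close>, which leaves
    only 1, 2, 3.\<close>
  have "a \<in> {1, 2, 3}"
    using u unfolding uj(1) block_word_in_cubic_lang_iff by blast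
  then have eqs: "0 < a" "j = k" "l = k"
    using uj vl by auto
  have "a \<noteq> b" "b \<noteq> c"
    using u v w wk vl(1) uj(1) eqs by auto
  then have abc: "a = 1" "b = 2" "c = 3"
    using \<open>0 < a\<close> c uj(2) vl(2) by auto
  show ?thesis
    using that[of k] u v w wk vl(1) uj(1) eqs
    by (auto simp: abc block_word_in_cubic_lang_iff)
qed

text \<open>The moduli are pairwise coprime: neighbours are consecutive numbers, and the outer two
  are odd with difference 2.\<close>

lemma modulus_product_dvd:
  assumes "n \<ge> 1" "modulus n 1 dvd k" "modulus n 2 dvd k" "modulus n 3 dvd k"
  shows "modulus n 1 * modulus n 2 * modulus n 3 dvd k"
proof -
  obtain t where "n = Suc t" using assms(1) by (cases n) auto
  then have m: "modulus n 1 = 2 * t + 1" "modulus n 2 = 2 * t + 2" "modulus n 3 = 2 * t + 3"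
    by (simp_all add: modulus_def)
  have "coprime (2 * t + 1) (2 * t + 2)" "coprime (2 * t + 2) (2 * t + 3)"
    using coprime_Suc_right_nat[of "2 * t + 1"] coprime_Suc_right_nat[of "2 * t + 2"]
    by (simp_all add: numeral_eq_Suc)
  moreover have "coprime (2 * t + 1) (2 * t + 3)"
  proof (rule coprimeI)
    fix d assume d: "d dvd 2 * t + 1" "d dvd 2 * t + 3"
    then have "d dvd (2 * t + 3) - (2 * t + 1)" by (rule dvd_diff_nat[rotated])
    then have "d dvd 2" by simp
    moreover have "d dvd Suc (2 * t)" using d by simp
    ultimately show "d dvd 1"
      by (metis d(1) coprime_common_divisor coprime_left_2_iff_odd even_plus_one_iff dvd_triv_left)
  qed
  ultimately show ?thesis
    using assms(2-4) unfolding m by (intro divides_mult) (simp_all only: coprime_mult_left_iff)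
qed

lemma cubic_lang_witness_length:
  assumes "n \<ge> 2" "suffix_convexity_witness (cubic_lang n) u v w"
  shows "n ^ 3 \<le> length w"
proof -
  obtain k where k: "w = block_word 3 k" "0 < k"
    "modulus n 1 dvd k" "modulus n 2 dvd k" "modulus n 3 dvd k"
    using assms(2) by (rule suffix_convexity_witness_cubic_langD)
  \<comment> \<open>Each factor is at least \<open>2 * n - 1 \<ge> n\<close>.\<close>
  have "n * n * n \<le> modulus n 1 * modulus n 2 * modulus n 3"
    using assms(1) by (intro mult_le_mono) (simp_all add: modulus_def)
  also have "\<dots> \<le> k"
    using modulus_product_dvd[of n k] assms(1) k by (intro dvd_imp_le) auto
  also have "\<dots> \<le> length w"
    by (simp add: k(1) block_word_def)
  finally show ?thesis
    by (simp add: power3_eq_cube)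
qed

lemma cubic_lang_not_suffix_convex:
  assumes "n \<ge> 2"
  shows "\<not> suffix_convex (cubic_lang n)"
proof -
  define k where "k = modulus n 1 * modulus n 2 * modulus n 3"
  have "modulus n 1 dvd k" "modulus n 2 dvd k" "modulus n 3 dvd k"
    unfolding k_def by simp_all
  moreover have "0 < k"
    using assms by (simp add: k_def modulus_def)
  ultimately have "suffix_convexity_witness (cubic_lang n)
      (block_word 1 k) (block_word 2 k) (block_word 3 k)"
    by (simp add: suffix_convexity_witness_def block_word_in_cubic_lang_iff suffix_block_word)
  then show ?thesis
    unfolding suffix_convex_def by blast
qed

section \<open>Correctness of the automaton\<close>

lemma is_dfa_cubic_dfa:
  assumes "n \<ge> 1"
  shows "is_dfa {0, 1} (cubic_dfa n)"
proof -
  have "cubic_step n q x < 8 * n + 8" if "q < 8 * n + 8" for q x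
  proof -
    have "q mod 4 < 4" "q = 4 * (q div 4) + q mod 4" by simp_all
    \<comment> \<open>This bounds the branch \<open>q + 4\<close> by
      \<open>4 * (2 * n) + 3 + 4 = 8 * n + 7\<close>; the other branches stay below 8.\<close>
    moreover have "q div 4 \<le> 2 * n" if "q div 4 < modulus n (q mod 4)"
      using that \<open>q mod 4 < 4\<close> assms by (simp add: modulus_def)
    ultimately show ?thesis
      using that unfolding cubic_step_def by (simp, linarith)
  qed
  then show ?thesis
    by (auto simp: is_dfa_def cubic_dfa_def)
qed

lemma block_word_snoc_zero: "block_word i k @ [0] = block_word i (Suc k)"
  by (simp add: block_word_def replicate_append_same)

lemma block_word_snoc_one: "block_word i 0 @ [1] = block_word (Suc i) 0"
  by (simp add: block_word_def replicate_append_same)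

lemma foldl_cubic_step_block_word:
  assumes "n \<ge> 2" "i \<in> {1, 2, 3}"
  shows "foldl (cubic_step n) 0 (block_word i k) =
    i + 4 * (if k = 0 then 0 else (k - 1) mod modulus n i + 1)"
proof (induction k)
  case 0
  show ?case
    using assms(2) by (auto simp: block_word_def cubic_step_def numeral_eq_Suc)
next
  case (Suc k)
  let ?m = "modulus n i"
  let ?j = "if k = 0 then 0 else (k - 1) mod ?m + 1"
  have m: "0 < ?m" using assms by (auto simp: modulus_def)
  have "?j \<le> ?m" using m by (auto simp: Suc_le_eq)
  have "k mod ?m + 1 = (if ?j < ?m then ?j + 1 else 1)"
    using m by (cases k) (auto simp: mod_Suc intro: Suc_lessI)
  moreover have "cubic_step n (i + 4 * ?j) 0 = i + 4 * (if ?j < ?m then ?j + 1 else 1)"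
    using assms(2) by (auto simp: cubic_step_def)
  ultimately show ?case
    using Suc.IH by (simp flip: block_word_snoc_zero)
qed

text \<open>This reduces acceptance to block words: a leading zero, a fourth one or a one after a
  zero leads to the sink for good.\<close>

lemma foldl_cubic_step_cases:
  assumes "n \<ge> 2" "w \<in> lists {0, 1}"
  shows "w = [] \<or> foldl (cubic_step n) 0 w = 4 \<or> (\<exists>i k. i \<in> {1, 2, 3} \<and> w = block_word i k)"
  using assms(2)
proof (induction w rule: rev_induct)
  case Nil
  show ?case by simp
next
  case (snoc x w)
  have x: "x = 0 \<or> x = 1" and "w \<in> lists {0, 1}" using snoc.prems by auto
  with snoc.IH consider "w = []" | "foldl (cubic_step n) 0 w = 4"
    | i k where "i \<in> {1, 2, 3}" "w = block_word i k"
    by blast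
  then show ?case
  proof cases
    case 1
    have "[1] = block_word 1 0" by (simp add: block_word_def)
    then show ?thesis using 1 x by (auto simp: cubic_step_def)
  next
    case 2
    moreover have "cubic_step n 4 x = 4" by (simp add: cubic_step_def)
    ultimately show ?thesis by simp
  next
    case (3 i k)
    show ?thesis
    proof (cases "x = 0")
      case True
      then show ?thesis using 3 block_word_snoc_zero by blast
    next
      case False
      with x have x1: "x = 1" by simp
      show ?thesis
      proof (cases "k = 0 \<and> i < 3")
        case True
        then have "Suc i \<in> {1, 2, 3}" "w @ [x] = block_word (Suc i) 0"
          using 3 x1 block_word_snoc_one[of i] by auto
        then show ?thesis by blast
      next
        case False
        \<comment> \<open>Either three ones have been read, or some zero has put the state above
          4.\<close>
        then have "3 \<le> foldl (cubic_step n) 0 w"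
          using 3 foldl_cubic_step_block_word[OF assms(1) 3(1), of k] by auto
        then have "cubic_step n (foldl (cubic_step n) 0 w) x = 4"
          using x1 unfolding cubic_step_def[of _ _ x] by simp
        then show ?thesis by simp
      qed
    qed
  qed
qed

lemma dfa_lang_cubic_dfa:
  assumes "n \<ge> 2"
  shows "dfa_lang {0, 1} (cubic_dfa n) = cubic_lang n"
proof -
  have iff: "foldl (cubic_step n) 0 (block_word i k) \<in> final (cubic_dfa n) \<longleftrightarrow>
      block_word i k \<in> cubic_lang n" if i: "i \<in> {1, 2, 3}" for i k
  proof -
    let ?m = "modulus n i"
    let ?j = "if k = 0 then 0 else (k - 1) mod ?m + 1"
    have m: "0 < ?m" "?m \<le> 2 * n + 1" using assms i by (auto simp: modulus_def)
    have "?j \<le> ?m" using m(1) by (auto simp: Suc_le_eq)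
    then have "i + 4 * ?j < 8 * n + 8" using m(2) i by auto
    moreover have "?j = ?m \<longleftrightarrow> 0 < k \<and> ?m dvd k"
      using m(1) by (cases k) (auto simp: dvd_eq_mod_eq_0 mod_Suc)
    moreover have "(i + 4 * ?j) mod 4 = i" "(i + 4 * ?j) div 4 = ?j"
      using i by auto
    ultimately show ?thesis
      using i unfolding foldl_cubic_step_block_word[OF assms i] block_word_in_cubic_lang_iff
      by (simp add: cubic_dfa_def) auto
  qed
  have "w \<in> dfa_lang {0, 1} (cubic_dfa n) \<longleftrightarrow> w \<in> cubic_lang n" for w
  proof
    assume w: "w \<in> dfa_lang {0, 1} (cubic_dfa n)"
    then have f: "foldl (cubic_step n) 0 w \<in> final (cubic_dfa n)" and "w \<in> lists {0, 1}"
      by (auto simp: dfa_lang_def cubic_dfa_def)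
    moreover have "0 \<notin> final (cubic_dfa n)" "4 \<notin> final (cubic_dfa n)"
      by (simp_all add: cubic_dfa_def)
    ultimately show "w \<in> cubic_lang n"
      using foldl_cubic_step_cases[OF assms, of w] iff by fastforce
  next
    assume "w \<in> cubic_lang n"
    moreover from this obtain i k where "i \<in> {1, 2, 3}" "w = block_word i k"
      by (auto simp: cubic_lang_def)
    moreover have "block_word i k \<in> lists {0, 1}"
      by (auto simp: block_word_def)
    ultimately show "w \<in> dfa_lang {0, 1} (cubic_dfa n)"
      using iff by (simp add: dfa_lang_def) (simp add: cubic_dfa_def)
  qed
  then show ?thesis by blast
qed

theorem theorem13:
  shows "\<exists>(\<Sigma> :: nat set) (c :: real) (L :: nat \<Rightarrow> nat list set) (M :: nat \<Rightarrow> (nat, nat) dfa).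
    finite \<Sigma> \<and> c > 0 \<and>
    (\<forall>n \<ge> 2.
       regular_lang \<Sigma> (L n) \<and>
       \<not> suffix_convex (L n) \<and>
       is_dfa \<Sigma> (M n) \<and> dfa_lang \<Sigma> (M n) = L n \<and>
       (\<forall>u v w. suffix_convexity_witness (L n) u v w \<longrightarrow> real (length w) \<ge> c * real n ^ 3)) \<and>
    (\<lambda>n. real (card (states (M n)))) \<in> O(\<lambda>n. real n)"
proof (intro exI conjI allI impI)
  show "finite {0, 1 :: nat}" by simp
  show "(0 :: real) < 1" by simp
  fix n :: nat assume n: "n \<ge> 2"
  show dfa: "is_dfa {0, 1} (cubic_dfa n)" using n by (intro is_dfa_cubic_dfa) simp
  show lang: "dfa_lang {0, 1} (cubic_dfa n) = cubic_lang n" using n by (rule dfa_lang_cubic_dfa)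
  show "regular_lang {0, 1} (cubic_lang n)"
    unfolding regular_lang_def using dfa lang by blast
  show "\<not> suffix_convex (cubic_lang n)" using n by (rule cubic_lang_not_suffix_convex)
  fix u v w assume "suffix_convexity_witness (cubic_lang n) u v w"
  then have "n ^ 3 \<le> length w" by (rule cubic_lang_witness_length[OF n])
  then show "1 * real n ^ 3 \<le> real (length w)"
    by (metis mult_1 of_nat_le_iff of_nat_power)
next
  show "(\<lambda>n. real (card (states (cubic_dfa n)))) \<in> O(\<lambda>n. real n)"
    \<comment> \<open>\<open>8 * n + 8 \<le> 16 * n\<close> once \<open>n \<ge> 1\<close>.\<close>
    by (rule bigoI[of _ 16], rule eventually_sequentiallyI[of 1]) (simp add: cubic_dfa_def)
qed

end
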